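(* Let $K$ be a field, $n\ge 1$, and $f(X,Y)=a_0(X)+a_1(X)Y+\cdots+a_n(X)Y^n\in K[X,Y]$, with $a_0,a_1,\dots,a_n\in K[X]$, $a_0a_n\neq 0$ and $$\deg a_n\ge\max\{\deg a_0,\deg a_1,\dots,\deg a_{n-1}\}.$$ If for a non-constant polynomial $g(X)\in K[X]$, the polynomial $f(X,g(X))$ is irreducible over $K$, then $f(X,Y)$, viewed as a polynomial in $Y$, is irreducible over $K(X)$.
   Context: All degrees are in $X$, and the zero polynomial has degree $-\infty$. *)

theory Defs
  imports "HOL-Computational_Algebra.Computational_Algebra"
begin

text \<open>
  Elements of \<open>K[X,Y] = K[X][Y]\<close> have type \<open>'a poly poly\<close>: the outer indeterminate is \<open>Y\<close>, the
  coefficients are polynomials in \<open>X\<close>, and \<open>K(X)\<close> is \<open>'a poly fract\<close>. Thus \<open>poly f g\<close> is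
  \<open>f(X, g(X))\<close>, and \<open>map_poly to_fract f\<close> is \<open>f\<close> viewed as a polynomial in \<open>Y\<close> over \<open>K(X)\<close>.

  The library sets \<open>degree 0 = 0\<close> instead of \<open>-\<infinity>\<close>. This does not change
  \<open>deg a\<^sub>n \<ge> max {deg a\<^sub>0, \<dots>, deg a\<^sub>n\<^sub>-\<^sub>1}\<close> when \<open>a\<^sub>0\<close> and \<open>a\<^sub>n\<close> are nonzero, as then both
  sides are at least 0 under either convention.
\<close>

end

theory Submission
  imports Defs
begin

text \<open>
  By Gauss's lemma it suffices to exclude a factorization \<open>f = p q\<close> in \<open>K[X][Y]\<close> with both factors
  of positive degree in \<open>Y\<close>. Call a polynomial in \<open>Y\<close> dominated if its leading coefficient has
  maximal degree in \<open>X\<close>. The maximal degree of the coefficients is additive on products, so both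
  factors of the dominated polynomial \<open>f\<close> are dominated. In \<open>p(X, g(X))\<close> the leading term of a
  dominated \<open>p\<close> has larger degree than all others, because \<open>deg g > 0\<close>; hence \<open>p(X, g(X))\<close> and
  \<open>q(X, g(X))\<close> are both non-constant, contradicting the irreducibility of \<open>f(X, g(X))\<close>.
\<close>

definition dominated :: "'a::zero poly poly \<Rightarrow> bool" where
  "dominated p \<longleftrightarrow> (\<forall>i. degree (coeff p i) \<le> degree (lead_coeff p))"

text \<open>In the convolution sum at index \<open>m + n\<close>, every term with
  \<open>k \<noteq> m\<close> has a factor whose index exceeds its degree bound. The bounds need not
  be attained, so both sides may vanish.\<close>

lemma coeff_mult_add_of_degree_le:
  fixes p q :: "'a::comm_semiring_0 poly"
  assumes "degree p \<le> m" "degree q \<le> n"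
  shows "coeff (p * q) (m + n) = coeff p m * coeff q n"
proof -
  have "coeff p k * coeff q (m + n - k) = (if k = m then coeff p m * coeff q n else 0)"
    if "k \<le> m + n" for k
  proof (cases k m rule: linorder_cases)
    case less
    then have "degree q < m + n - k" using assms(2) by linarith
    with less show ?thesis by (simp add: coeff_eq_0)
  next
    case greater
    then have "degree p < k" using assms(1) by linarith
    with greater show ?thesis by (simp add: coeff_eq_0)
  qed simp
  then have "coeff (p * q) (m + n) = (\<Sum>k\<le>m + n. if k = m then coeff p m * coeff q n else 0)"
    unfolding coeff_mult by (intro sum.cong) auto
  then show ?thesis by simp
qed

lemma max_coeff_degree:
  fixes p :: "'a::zero poly poly"
  assumes "p \<noteq> 0"
  obtains m k where "\<And>i. degree (coeff p i) \<le> m" "coeff (coeff p k) m \<noteq> 0"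
proof -
  define S where "S = {i. coeff p i \<noteq> 0}"
  have "finite S"
    unfolding S_def by (rule finite_subset[of _ "{..degree p}"]) (auto intro: le_degree)
  moreover have "S \<noteq> {}"
    using assms by (auto simp: S_def poly_eq_iff)
  ultimately obtain k where k: "k \<in> S" "\<And>i. i \<in> S \<Longrightarrow> degree (coeff p i) \<le> degree (coeff p k)"
    using Max_in[of "(\<lambda>i. degree (coeff p i)) ` S"] Max_ge[of "(\<lambda>i. degree (coeff p i)) ` S"]
    by (metis (no_types, lifting) finite_imageI imageE imageI image_is_empty)
  have "degree (coeff p i) \<le> degree (coeff p k)" for i
    using k(2)[of i] by (cases "i \<in> S") (auto simp: S_def)
  moreover have "coeff (coeff p k) (degree (coeff p k)) \<noteq> 0"
    using k(1) by (simp add: S_def)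
  ultimately show thesis using that by blast
qed

lemma dominated_factor:
  fixes p q :: "'a::idom poly poly"
  assumes dom: "dominated (p * q)" and nz: "p * q \<noteq> 0"
  shows "dominated p"
proof -
  from nz have "p \<noteq> 0" "q \<noteq> 0" by auto
  obtain m k where m: "\<And>i. degree (coeff p i) \<le> m" "coeff (coeff p k) m \<noteq> 0"
    using max_coeff_degree[OF \<open>p \<noteq> 0\<close>] by metis
  obtain n l where n: "\<And>i. degree (coeff q i) \<le> n" "coeff (coeff q l) n \<noteq> 0"
    using max_coeff_degree[OF \<open>q \<noteq> 0\<close>] by metis
  \<comment> \<open>Read as polynomials in \<open>X\<close> over \<open>K[Y]\<close>,
    \<open>p\<close> and \<open>q\<close> have degrees \<open>m\<close> and \<open>n\<close>, and
    these maps extract their leading coefficients, which multiply. Over a domain their product is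
    nonzero, so some coefficient of \<open>p * q\<close> has degree at least
    \<open>m + n\<close>.\<close>
  have top: "map_poly (\<lambda>c. coeff c (m + n)) (p * q)
      = map_poly (\<lambda>c. coeff c m) p * map_poly (\<lambda>c. coeff c n) q"
    by (rule poly_eqI)
      (simp add: coeff_map_poly coeff_mult[of p q] coeff_mult[of "map_poly _ p"] coeff_sum
        coeff_mult_add_of_degree_le m n)
  have "map_poly (\<lambda>c. coeff c m) p \<noteq> 0" "map_poly (\<lambda>c. coeff c n) q \<noteq> 0"
    using m(2) n(2) by (auto simp: poly_eq_iff coeff_map_poly)
  with top have "map_poly (\<lambda>c. coeff c (m + n)) (p * q) \<noteq> 0" by simp
  then obtain i where "coeff (coeff (p * q) i) (m + n) \<noteq> 0"
    by (auto simp: poly_eq_iff coeff_map_poly)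
  then have "m + n \<le> degree (coeff (p * q) i)" by (rule le_degree)
  also have "\<dots> \<le> degree (lead_coeff (p * q))" using dom by (simp add: dominated_def)
  also have "\<dots> = degree (lead_coeff p) + degree (lead_coeff q)"
    using \<open>p \<noteq> 0\<close> \<open>q \<noteq> 0\<close> by (simp only: lead_coeff_mult) (simp add: degree_mult_eq)
  also have "\<dots> \<le> degree (lead_coeff p) + n" using n(1) by simp
  finally have "m \<le> degree (lead_coeff p)" by simp
  then show ?thesis unfolding dominated_def using m(1) order_trans by blast
qed

text \<open>Each step down in the power of \<open>g\<close> costs \<open>degree g > 0\<close>, and
  domination prevents a lower coefficient from making up for it. The top term thus has strictly the
  largest degree and cannot cancel.\<close>

lemma degree_poly_dominated:
  fixes p :: "'a::idom poly poly" and g :: "'a poly"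
  assumes dom: "dominated p" and "degree p > 0" and "degree g > 0"
  shows "degree (poly p g) = degree (lead_coeff p) + degree p * degree g"
proof -
  define N where "N = degree (lead_coeff p) + degree p * degree g"
  have "N > 0" using assms by (simp add: N_def)
  have "p \<noteq> 0" "g \<noteq> 0" using assms by auto
  have lead: "degree (lead_coeff p * g ^ degree p) = N"
    using \<open>p \<noteq> 0\<close> \<open>g \<noteq> 0\<close> by (simp add: degree_mult_eq degree_power_eq N_def)
  have "degree (coeff p i * g ^ i) < N" if "i < degree p" for i
  proof -
    have "degree (coeff p i * g ^ i) \<le> degree (coeff p i) + degree (g ^ i)"
      by (rule degree_mult_le)
    also have "\<dots> \<le> degree (lead_coeff p) + i * degree g"
      using dom \<open>g \<noteq> 0\<close> by (simp add: dominated_def degree_power_eq)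
    also have "\<dots> < N" using that \<open>degree g > 0\<close> by (simp add: N_def)
    finally show ?thesis .
  qed
  then have "degree (\<Sum>i<degree p. coeff p i * g ^ i) < N"
    using \<open>N > 0\<close> by (intro degree_sum_less) auto
  moreover have "poly p g = (\<Sum>i<degree p. coeff p i * g ^ i) + lead_coeff p * g ^ degree p"
    by (simp add: poly_altdef lessThan_Suc_atMost[symmetric])
  ultimately show ?thesis
    using lead by (simp add: degree_add_eq_right N_def)
qed

text \<open>A divisor of least positive degree is irreducible, and over a field irreducible
  polynomials are prime.\<close>

lemma exists_prime_elem_dvd:
  fixes d :: "'a::field poly"
  assumes "degree d > 0"
  obtains c where "prime_elem c" "c dvd d" "degree c > 0"
proof -
  obtain c where c: "c dvd d \<and> degree c > 0"
    and min: "\<And>b. b dvd d \<and> degree b > 0 \<Longrightarrow> degree c \<le> degree b"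
    using ex_has_least_nat[of "\<lambda>c. c dvd d \<and> degree c > 0" d degree] assms by auto
  have "irreducible c"
  proof (rule irreducibleI)
    show "c \<noteq> 0" using c by auto
    then show "\<not> c dvd 1" using c by (simp add: is_unit_iff_degree)
  next
    fix a b assume ab: "c = a * b"
    with c have nz: "a \<noteq> 0" "b \<noteq> 0" by auto
    then have "degree c = degree a + degree b" using ab by (simp add: degree_mult_eq)
    moreover have "a dvd d" "b dvd d" using c ab dvd_trans by (metis dvd_triv_left, metis dvd_mult_right)
    \<comment> \<open>If both degrees were positive, each would be at least \<open>degree c\<close>
      by minimality, yet they add up to \<open>degree c\<close>.\<close>
    ultimately have "degree a = 0 \<or> degree b = 0" using min[of a] min[of b] by fastforce
    with nz show "a dvd 1 \<or> b dvd 1" by (auto simp: is_unit_iff_degree)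
  qed
  then show thesis using that c field_poly_irreducible_imp_prime by blast
qed

text \<open>
  Gauss's lemma by descent on \<open>degree d\<close>; the content-based version of the library needs a
  \<open>gcd\<close> operation on the coefficient ring, which \<open>'a poly\<close> lacks for a general field.
\<close>

lemma smult_eq_mult_imp_factorization:
  fixes d :: "'a::field poly" and f p q :: "'a poly poly"
  assumes "d \<noteq> 0" and "smult d f = p * q"
  shows "\<exists>p' q'. f = p' * q' \<and> degree p' = degree p \<and> degree q' = degree q"
  using assms
proof (induction "degree d" arbitrary: d p q rule: less_induct)
  case less
  show ?case
  proof (cases "degree d = 0")
    case True
    \<comment> \<open>Here \<open>d\<close> is a unit, and its inverse \<open>b\<close> is absorbed
      into \<open>p\<close>.\<close>
    then obtain b where b: "d dvd 1" "1 = d * b"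
      using less.prems(1) by (metis is_unit_iff_degree dvdE)
    then have "b \<noteq> 0" by auto
    have "f = smult b p * q"
      using less.prems(2) b(2)
      by (metis mult.commute mult_smult_left smult_1_left smult_smult)
    then show ?thesis using \<open>b \<noteq> 0\<close> by (intro exI[of _ "smult b p"] exI[of _ q]) simp
  next
    case False
    then obtain c where c: "prime_elem c" "c dvd d" "degree c > 0"
      using exists_prime_elem_dvd by blast
    then obtain e where e: "d = c * e" by (auto elim: dvdE)
    have nz: "c \<noteq> 0" "e \<noteq> 0" using e less.prems(1) by auto
    have deg: "degree e < degree d" using c(3) nz by (simp add: e degree_mult_eq)
    \<comment> \<open>A prime \<open>c\<close> of \<open>K[X]\<close> stays prime as a constant of
      \<open>K[X][Y]\<close>, so it divides one of the factors and can be cancelled there without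
      changing degrees in \<open>Y\<close>.\<close>
    have "[:c:] dvd p * q"
      by (rule dvdI[of _ _ "smult e f"]) (simp add: less.prems(2)[symmetric] e mult.commute)
    moreover have "prime_elem [:c:]" using c(1) by (simp add: lift_prime_elem_poly)
    ultimately have "[:c:] dvd p \<or> [:c:] dvd q" by (rule prime_elem_dvd_multD[rotated])
    then show ?thesis
    proof
      assume "[:c:] dvd p"
      then obtain r where r: "p = smult c r" by (auto elim: dvdE)
      then have "smult c (smult e f) = smult c (r * q)" using less.prems(2) e by simp
      then have "smult e f = r * q" by (rule smult_cancel[OF nz(1)])
      from less.hyps[OF deg nz(2) this] show ?thesis using r nz(1) by simp
    next
      assume "[:c:] dvd q"
      then obtain r where r: "q = smult c r" by (auto elim: dvdE)
      then have "smult c (smult e f) = smult c (p * r)" using less.prems(2) e by simp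
      then have "smult e f = p * r" by (rule smult_cancel[OF nz(1)])
      from less.hyps[OF deg nz(2) this] show ?thesis using r nz(1) by simp
    qed
  qed
qed

lemma clear_denominators:
  fixes P :: "'a::idom fract poly"
  obtains d p where "d \<noteq> 0" "smult (to_fract d) P = map_poly to_fract p"
proof -
  have "\<exists>d p. d \<noteq> 0 \<and> smult (to_fract d) P = map_poly to_fract p"
  proof (induction P)
    case 0
    show ?case by (intro exI[of _ 1] exI[of _ 0]) simp
  next
    case (pCons c P)
    then obtain d p where dp: "d \<noteq> 0" "smult (to_fract d) P = map_poly to_fract p" by blast
    obtain a b where ab: "c = Fract a b" "b \<noteq> 0" by (cases c) auto
    \<comment> \<open>The common denominator \<open>d\<close> of the tail is multiplied by the
      denominator \<open>b\<close> of the new coefficient.\<close>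
    have "to_fract (b * d) * c = to_fract (d * a)"
      using ab by (simp add: Fract_conv_to_fract)
    moreover have "smult (to_fract (b * d)) P = map_poly to_fract (smult b p)"
      using arg_cong[OF dp(2), of "smult (to_fract b)"] by simp
    ultimately have "smult (to_fract (b * d)) (pCons c P)
        = map_poly to_fract (pCons (d * a) (smult b p))"
      by (simp add: map_poly_pCons del: to_fract_mult fract_poly_smult)
    then show ?case using dp(1) ab(2) by (intro exI[of _ "b * d"]) auto
  qed
  then show thesis using that by blast
qed

text \<open>Clearing denominators in \<open>P\<close> and \<open>Q\<close> gives a factorization of
  \<open>smult (d * e) f\<close> over \<open>K[X]\<close>; the descent then removes the scalar
  \<open>d * e\<close>.\<close>

lemma fract_poly_factorization:
  fixes f :: "'a::field poly poly"
  assumes "map_poly to_fract f = P * Q"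
  obtains p q where "f = p * q" "degree p = degree P" "degree q = degree Q"
proof -
  obtain d p where p: "d \<noteq> 0" "smult (to_fract d) P = map_poly to_fract p"
    by (rule clear_denominators)
  obtain e q where q: "e \<noteq> 0" "smult (to_fract e) Q = map_poly to_fract q"
    by (rule clear_denominators)
  have "map_poly to_fract (smult (d * e) f) = smult (to_fract d) P * smult (to_fract e) Q"
    by (simp add: assms mult.commute)
  also have "\<dots> = map_poly to_fract (p * q)" by (simp add: p q)
  finally have "smult (d * e) f = p * q" by (simp only: fract_poly_eq_iff)
  moreover have "degree p = degree P" "degree q = degree Q"
    using arg_cong[OF p(2), of degree] arg_cong[OF q(2), of degree] p(1) q(1)
    by (simp_all add: degree_map_poly)
  ultimately show thesis
    using that smult_eq_mult_imp_factorization[of "d * e" f p q] p(1) q(1) by auto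
qed

theorem corollary1p10:
  fixes a :: "nat \<Rightarrow> 'a::field poly" and f :: "'a poly poly" and g :: "'a poly" and n :: nat
  assumes "n \<ge> 1"
    and "f = (\<Sum>i\<le>n. monom (a i) i)"
    and "a 0 * a n \<noteq> 0"
    and "degree (a n) \<ge> (MAX i\<in>{..<n}. degree (a i))"
    and "degree g > 0"
    and "irreducible (poly f g)"
  shows "irreducible (map_poly to_fract f)"
proof -
  have coeff_f: "coeff f i = (if i \<le> n then a i else 0)" for i
    by (simp add: assms(2) coeff_sum coeff_monom)
  have "degree f = n"
    using assms(3) by (intro antisym degree_le le_degree) (auto simp: coeff_f)
  then have "f \<noteq> 0" using assms(1) by auto
  have "degree (a i) \<le> degree (a n)" if "i < n" for i
    using that by (intro order_trans[OF Max_ge assms(4)]) auto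
  then have "dominated f"
    unfolding dominated_def \<open>degree f = n\<close> by (auto simp: coeff_f le_less)
  \<comment> \<open>A factor of positive degree in \<open>Y\<close> would be dominated, so its value
    at \<open>g\<close> would be non-constant and not a unit.\<close>
  have const: "degree p = 0" if "f = p * q" "is_unit (poly p g)" for p q
  proof (rule ccontr)
    assume "degree p \<noteq> 0"
    moreover have "dominated p"
      using dominated_factor[of p q] that(1) \<open>dominated f\<close> \<open>f \<noteq> 0\<close> by simp
    ultimately have "degree (poly p g) > 0"
      using degree_poly_dominated[of p g] assms(5) by simp
    then show False using that(2) by (auto elim: is_unit_polyE)
  qed
  show ?thesis
  proof (rule irreducibleI)
    show "map_poly to_fract f \<noteq> 0" using \<open>f \<noteq> 0\<close> by simp
    show "\<not> is_unit (map_poly to_fract f)"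
      using \<open>f \<noteq> 0\<close> \<open>degree f = n\<close> assms(1)
      by (simp add: is_unit_iff_degree degree_map_poly)
  next
    fix P Q assume PQ: "map_poly to_fract f = P * Q"
    then have nz: "P \<noteq> 0" "Q \<noteq> 0" using \<open>f \<noteq> 0\<close> by auto
    from PQ obtain p q where pq: "f = p * q" "degree p = degree P" "degree q = degree Q"
      by (rule fract_poly_factorization)
    have "is_unit (poly p g) \<or> is_unit (poly q g)"
      using assms(6) by (rule irreducibleD) (simp add: pq(1))
    then have "degree P = 0 \<or> degree Q = 0"
      using const[of p q] const[of q p] pq by (auto simp: mult.commute)
    \<comment> \<open>Over the field \<open>K(X)\<close>, nonzero polynomials of degree 0 in
      \<open>Y\<close> are units.\<close>
    with nz show "is_unit P \<or> is_unit Q" by (auto simp: is_unit_iff_degree)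
  qed
qed

end
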